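(* Let $M$ be a metric space with the base point $e$. Let $\tau$ be any topology on the space $C(M)$ lying between the pointwise topology $\tau_p$ and the compact-open topology $\tau_k$, i.e. $\tau_p\subseteq\tau\subseteq\tau_k$. Then $$ww(M)=d(C(M),\tau)=d(\mathrm{LIP}(M),\tau)=d(\mathrm{Lip}(M),\tau)=d(\mathrm{Lip}_0(M),\tau)\le d(M).$$
   Context: $C(M)$ is the set of all continuous real-valued functions on $M$. The base point $e$ is a distinguished point of $M$. $\mathrm{LIP}(M)$ is the set of all Lipschitz real-valued functions on $M$, $\mathrm{Lip}(M)$ the set of all bounded functions in $\mathrm{LIP}(M)$, and $\mathrm{Lip}_0(M)$ the set of all $f\in\mathrm{LIP}(M)$ with $f(e)=0$; here all three are considered as subspaces of $C(M)$ with the subspace topology, still denoted $\tau$. $\tau_p$ is the topology of pointwise convergence (inherited from $\mathbb{R}^M$) and $\tau_k$ is the compact-open topology. For a topological space $X$: $d(X)$ is the density (minimal cardinality of a dense subset), $w(X)$ is the weight (minimal cardinality of a base), and, for Tychonoff $X$, the weak weight $ww(X)$ is the minimal weight $w(Y)$ of a Tychonoff space $Y$ such that there exists a continuous bijection $\varphi\colon X\to Y$.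
   Formalization: For finite M with n points the literal claim fails (ww(M)=d(M)=n but d(C(M))=ℵ₀), so the chain is proved literally for infinite M, and for every M, finite or not, with ℵ₀ added to each of the cardinals. *)

theory Defs
  imports "HOL-Analysis.Analysis"
begin

unbundle cardinal_syntax

(* Cardinals are represented by cardinal orders and compared, possibly across types,
   by =o and \<le>o. A least element of a set of cardinals is unique only up to =o. *)
definition least_card :: "'b rel set \<Rightarrow> 'b rel" where
  "least_card R = (SOME r. r \<in> R \<and> (\<forall>s\<in>R. r \<le>o s))"

lemma least_card:
  assumes "R \<noteq> {}" "\<And>r. r \<in> R \<Longrightarrow> Card_order r"
  shows "least_card R \<in> R" "s \<in> R \<Longrightarrow> least_card R \<le>o s"
proof -
  have "\<exists>r. r \<in> R \<and> (\<forall>s\<in>R. r \<le>o s)"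
    using exists_minim_Well_order[of R] assms by (auto simp: card_order_on_def)
  from someI_ex[OF this] show "least_card R \<in> R" "s \<in> R \<Longrightarrow> least_card R \<le>o s"
    by (auto simp: least_card_def)
qed

(* The invariants below are the literal minimal cardinalities and may be finite; under the
   convention that cardinal functions take only infinite values, r stands for r +c natLeq. *)
definition top_density :: "'b topology \<Rightarrow> 'b rel" where
  "top_density X = least_card {|D| |D. D \<subseteq> topspace X \<and> X closure_of D = topspace X}"

definition is_base :: "'b topology \<Rightarrow> 'b set set \<Rightarrow> bool" where
  "is_base X \<B> \<longleftrightarrow> (\<forall>V\<in>\<B>. openin X V) \<and>
     (\<forall>U x. openin X U \<and> x \<in> U \<longrightarrow> (\<exists>V\<in>\<B>. x \<in> V \<and> V \<subseteq> U))"

definition weight :: "'b topology \<Rightarrow> 'b set rel" where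
  "weight X = least_card {|\<B>| |\<B>. is_base X \<B>}"

definition tychonoff_space :: "'b topology \<Rightarrow> bool" where
  "tychonoff_space X \<longleftrightarrow> completely_regular_space X \<and> Hausdorff_space X"

(* Y ranges over spaces whose points have the same type as those of X. This is no
   restriction, since Y is in bijection with X: see weak_weight_le below. *)
definition weak_weight :: "'b topology \<Rightarrow> 'b set rel" where
  "weak_weight X = least_card {weight Y |Y. tychonoff_space Y \<and>
     (\<exists>\<phi>. continuous_map X Y \<phi> \<and> bij_betw \<phi> (topspace X) (topspace Y))}"

lemma is_base_all: "is_base X {U. openin X U}"
  by (auto simp: is_base_def)

lemma weight_attained: "\<exists>\<B>. is_base X \<B> \<and> weight X = |\<B>|"
proof -
  have "weight X \<in> {|\<B>| |\<B>. is_base X \<B>}"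
    unfolding weight_def
    by (rule least_card(1)) (use is_base_all card_of_Card_order in blast)+
  then show ?thesis by blast
qed

lemma weight_le: "is_base X \<B> \<Longrightarrow> weight X \<le>o |\<B>|"
  unfolding weight_def by (rule least_card(2)) (use card_of_Card_order in blast)+

lemma card_order_weight: "Card_order (weight X)"
  by (metis weight_attained card_of_Card_order)

lemma weak_weight_le:
  fixes X :: "'b topology" and Y :: "'c topology"
  assumes Y: "tychonoff_space Y"
    and cont: "continuous_map X Y \<phi>" and bij: "bij_betw \<phi> (topspace X) (topspace Y)"
  shows "weak_weight X \<le>o weight Y"
proof -
  define Z where "Z = pullback_topology (topspace X) \<phi> Y"
  have Zo: "openin Z U \<longleftrightarrow> (\<exists>V. openin Y V \<and> U = \<phi> -` V \<inter> topspace X)" for U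
    by (simp add: Z_def openin_pullback_topology)
  have im: "\<phi> ` topspace X = topspace Y" and inj: "inj_on \<phi> (topspace X)"
    using bij by (auto simp: bij_betw_def)
  have Zt: "topspace Z = topspace X"
    using im by (auto simp: Z_def topspace_pullback_topology)
  have img: "\<phi> ` (\<phi> -` V \<inter> topspace X) = V" if "openin Y V" for V
  proof -
    have "V \<subseteq> \<phi> ` topspace X" using openin_subset[OF that] im by simp
    then show ?thesis by blast
  qed
  have hom: "homeomorphic_map Z Y \<phi>"
  proof (rule bijective_open_imp_homeomorphic_map)
    have "openin Z {x \<in> topspace Z. \<phi> x \<in> U}" if "openin Y U" for U
      unfolding Zo by (rule exI[of _ U]) (use that Zt in blast)
    moreover have "\<phi> \<in> topspace Z \<rightarrow> topspace Y" using im Zt by blast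
    ultimately show "continuous_map Z Y \<phi>" by (simp add: continuous_map_def)
    show "open_map Z Y \<phi>" unfolding open_map_def Zo using img by metis
    show "\<phi> ` topspace Z = topspace Y" "inj_on \<phi> (topspace Z)" using im inj by (auto simp: Zt)
  qed
  then have "Z homeomorphic_space Y"
    using homeomorphic_map_imp_homeomorphic_space by blast
  then have tZ: "tychonoff_space Z"
    using Y homeomorphic_completely_regular_space homeomorphic_Hausdorff_space
    unfolding tychonoff_space_def by blast
  have idc: "continuous_map X Z id"
  proof -
    have "openin X {x \<in> topspace X. id x \<in> U}" if "openin Z U" for U
    proof -
      obtain V where V: "openin Y V" "U = \<phi> -` V \<inter> topspace X" using \<open>openin Z U\<close> Zo by blast
      then have "{x \<in> topspace X. id x \<in> U} = {x \<in> topspace X. \<phi> x \<in> V}" by auto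
      then show ?thesis using cont V(1) by (simp add: continuous_map_def)
    qed
    then show ?thesis by (simp add: continuous_map_def Zt)
  qed
  have "bij_betw id (topspace X) (topspace Z)" by (simp add: Zt)
  with idc tZ have "weight Z \<in> {weight Y |Y. tychonoff_space Y \<and>
     (\<exists>\<phi>. continuous_map X Y \<phi> \<and> bij_betw \<phi> (topspace X) (topspace Y))}"
    by blast
  then have 1: "weak_weight X \<le>o weight Z"
    unfolding weak_weight_def
    by (intro least_card(2)) (use card_order_weight in blast)+
  obtain \<B> where \<B>: "is_base Y \<B>" "weight Y = |\<B>|" using weight_attained by blast
  let ?C = "(\<lambda>V. \<phi> -` V \<inter> topspace X) ` \<B>"
  have "is_base Z ?C"
    unfolding is_base_def
  proof (intro conjI allI impI)
    show "\<forall>V\<in>?C. openin Z V" using \<B> by (auto simp: is_base_def Zo)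
  next
    fix U x assume "openin Z U \<and> x \<in> U"
    then obtain W where W: "openin Y W" "U = \<phi> -` W \<inter> topspace X" "\<phi> x \<in> W" "x \<in> topspace X"
      using Zo by auto
    then obtain V where V: "V \<in> \<B>" "\<phi> x \<in> V" "V \<subseteq> W"
      using \<B>(1) unfolding is_base_def by blast
    show "\<exists>V\<in>?C. x \<in> V \<and> V \<subseteq> U"
      by (rule bexI[of _ "\<phi> -` V \<inter> topspace X"]) (use V W in auto)
  qed
  then have 2: "weight Z \<le>o |?C|" by (rule weight_le)
  have 3: "|?C| \<le>o |\<B>|" by (rule card_of_image)
  show ?thesis unfolding \<B>(2) by (rule ordLeq_transitive[OF 1 ordLeq_transitive[OF 2 3]])
qed

definition C_fun :: "('a::metric_space \<Rightarrow> real) set" where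
  "C_fun = {f. continuous_on UNIV f}"

definition LIP :: "('a::metric_space \<Rightarrow> real) set" where
  "LIP = {f. \<exists>L. L-lipschitz_on UNIV f}"

definition Lip :: "('a::metric_space \<Rightarrow> real) set" where
  "Lip = {f \<in> LIP. bounded (range f)}"

definition Lip0 :: "'a::metric_space \<Rightarrow> ('a \<Rightarrow> real) set" where
  "Lip0 e = {f \<in> LIP. f e = 0}"

definition pointwise_topology :: "('a::metric_space \<Rightarrow> real) topology" where
  "pointwise_topology = subtopology (powertop_real UNIV) C_fun"

definition compact_open_topology :: "('a::metric_space \<Rightarrow> real) topology" where
  "compact_open_topology =
     topology_generated_by {{f \<in> C_fun. f ` K \<subseteq> U} |K U. compact K \<and> open U}"

end

theory Submission
  imports Defs
begin

text \<open>
  Both inequalities behind the equalities go through families of functions that separate the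
  points of the metric space \<open>M\<close>.

  If \<open>A \<subseteq> C(M)\<close> separates points and \<open>D\<close> is dense in \<open>A\<close>, then \<open>D\<close> separates points too, since
  already the pointwise topology sees the two values \<open>f x \<noteq> f y\<close>. The topology that \<open>D\<close> generates on
  \<open>M\<close> is coarser than the given one, Tychonoff, and has a base of size at most \<open>|D| + \<aleph>\<^sub>0\<close>; hence the weak
  weight of \<open>M\<close> is at most \<open>|D| + \<aleph>\<^sub>0\<close> (\<open>weak_weight_le_density_subspace\<close>).

  Conversely, let \<open>\<kappa>\<close> be an infinite cardinal bounding the weak weight. A coarser Tychonoff topology
  with at most \<open>\<kappa>\<close> basic open sets provides at most \<open>\<kappa>\<close> continuous functions \<open>M \<rightarrow> [0,1]\<close> that
  separate points (\<open>separating_family_of_weak_weight\<close>). They need not be Lipschitz, but each such \<open>f\<close>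
  is the pointwise supremum over \<open>n\<close> of the Lipschitz functions \<open>x \<mapsto> inf\<^sub>y (f y + n d(x,y))\<close>, so
  these countably many minorants still tell apart any two points that \<open>f\<close> tells apart
  (\<open>lipschitz_minorants_separate\<close>). This is the point where the metric enters. Closing the minorants
  and the rational constants under sums and products gives a set of at most \<open>\<kappa>\<close> bounded Lipschitz
  functions, and by the Stone-Weierstrass theorem it approximates every continuous function uniformly
  on every compact set (\<open>small_Lip_subset_approximating\<close>). It is therefore dense in every space between
  \<open>Lip(M)\<close> and \<open>C(M)\<close>, for the compact-open topology and all coarser ones. Subtracting from each member
  its value at \<open>e\<close>, and approximating on \<open>K \<union> {e}\<close> instead of \<open>K\<close>, gives a dense subset of
  \<open>Lip\<^sub>0(M)\<close>.

  The last inequality holds because the balls of radius \<open>1/(n+1)\<close> around a dense set form a base of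
  \<open>M\<close>. All this is up to adding \<open>\<aleph>\<^sub>0\<close>; when \<open>M\<close> is infinite, every cardinal involved is infinite and
  absorbs that summand.
\<close>

section \<open>Cardinal arithmetic\<close>

lemma countable_ordLeq_Cinfinite:
  assumes "countable A" "Cinfinite r"
  shows "|A| \<le>o r"
proof -
  have "|A| \<le>o |UNIV :: nat set|"
    using assms(1) unfolding countable_def card_of_ordLeq[symmetric] by auto
  also have "|UNIV :: nat set| =o natLeq" by (rule card_of_nat)
  also have "natLeq \<le>o r" using assms(2) by (rule natLeq_ordLeq_cinfinite)
  finally show ?thesis .
qed

lemma Times_Cinfinite_bound:
  assumes "|A| \<le>o r" "|B| \<le>o r" "Cinfinite r"
  shows "|A \<times> B| \<le>o r"
  using assms by (auto simp: cinfinite_def intro: card_of_Times_ordLeq_infinite_Field)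

lemma image_ordLeq: "|A| \<le>o r \<Longrightarrow> |f ` A| \<le>o r"
  by (rule ordLeq_transitive[OF card_of_image])

lemma Cinfinite_card_of: "infinite A \<Longrightarrow> Cinfinite |A|"
  by (simp add: cinfinite_def Field_card_of card_of_card_order_on)

lemma Cinfinite_csum_natLeq: "Cinfinite (r +c natLeq)"
  using natLeq_Cinfinite by (intro Cinfinite_csum) blast

lemma csum_natLeq_absorb:
  fixes r :: "'b rel"
  shows "Cinfinite r \<Longrightarrow> r +c natLeq =o r"
  by (intro csum_absorb1 natLeq_ordLeq_cinfinite)

lemma csum_natLeq_cancel:
  fixes r :: "'b rel" and s :: "'c rel"
  assumes "r +c natLeq =o s +c natLeq" "Cinfinite r" "Cinfinite s"
  shows "r =o s"
  using assms csum_natLeq_absorb ordIso_symmetric ordIso_transitive by metis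

text \<open>
  Finitely many applications of countably many binary operations do not enlarge a set beyond an
  infinite bound. This serves twice: for the finite intersections of a subbase, and for the
  subring generated by a set of functions. The last property of \<open>A\<close>, being contained in every
  closed superset of \<open>G\<close>, shows that its members inherit what the operations preserve.
\<close>
lemma exists_operation_closed_superset:
  fixes G :: "'b set" and P :: "('b \<Rightarrow> 'b \<Rightarrow> 'b) set"
  assumes r: "Cinfinite r" and G: "|G| \<le>o r" and P: "countable P"
  obtains A where "G \<subseteq> A" "\<And>p x y. p \<in> P \<Longrightarrow> x \<in> A \<Longrightarrow> y \<in> A \<Longrightarrow> p x y \<in> A"
    "|A| \<le>o r"
    "\<And>B. G \<subseteq> B \<Longrightarrow> (\<And>p x y. p \<in> P \<Longrightarrow> x \<in> B \<Longrightarrow> y \<in> B \<Longrightarrow> p x y \<in> B) \<Longrightarrow> A \<subseteq> B"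
proof -
  define step where "step X = X \<union> (\<lambda>(p, x, y). p x y) ` (P \<times> X \<times> X)" for X :: "'b set"
  define L where "L n = (step ^^ n) G" for n
  define A where "A = (\<Union>n. L n)"
  have L0: "L 0 = G" and LS: "L (Suc n) = step (L n)" for n by (simp_all add: L_def)
  have mono: "L m \<subseteq> L n" if "m \<le> n" for m n
    using that by (induction rule: dec_induct) (auto simp: LS step_def)
  show ?thesis
  proof
    show "G \<subseteq> A" using L0 by (auto simp: A_def)
  next
    fix p x y assume p: "p \<in> P" and "x \<in> A" "y \<in> A"
    then obtain m n where "x \<in> L m" "y \<in> L n" by (auto simp: A_def)
    then have "x \<in> L (max m n)" "y \<in> L (max m n)"
      using mono[of m "max m n"] mono[of n "max m n"] by auto
    then have "(p, x, y) \<in> P \<times> L (max m n) \<times> L (max m n)" using p by simp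
    then have "p x y \<in> L (Suc (max m n))" unfolding LS step_def by force
    then show "p x y \<in> A" by (auto simp: A_def)
  next
    have "|L n| \<le>o r" for n
    proof (induction n)
      case 0
      show ?case using G by (simp add: L0)
    next
      case (Suc n)
      have "|P \<times> L n \<times> L n| \<le>o r"
        using r by (intro Times_Cinfinite_bound Suc countable_ordLeq_Cinfinite P)
      then show ?case
        unfolding LS step_def by (intro Un_Cinfinite_bound image_ordLeq Suc r)
    qed
    then show "|A| \<le>o r"
      unfolding A_def using r
      by (intro UNION_Cinfinite_bound countable_ordLeq_Cinfinite) auto
  next
    fix B assume B: "G \<subseteq> B" "\<And>p x y. p \<in> P \<Longrightarrow> x \<in> B \<Longrightarrow> y \<in> B \<Longrightarrow> p x y \<in> B"
    have "L n \<subseteq> B" for n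
    proof (induction n)
      case (Suc n)
      then show ?case using B(2) by (fastforce simp: LS step_def)
    qed (use B(1) L0 in simp)
    then show "A \<subseteq> B" by (auto simp: A_def)
  qed
qed

section \<open>Density and weak weight\<close>

lemma top_density_attained:
  obtains D where "D \<subseteq> topspace X" "X closure_of D = topspace X" "top_density X = |D|"
proof -
  let ?R = "{|D| |D. D \<subseteq> topspace X \<and> X closure_of D = topspace X}"
  have "top_density X \<in> ?R"
    unfolding top_density_def
  proof (rule least_card(1))
    have "|topspace X| \<in> ?R"
      by (intro CollectI exI[of _ "topspace X"] conjI refl subset_refl closure_of_topspace)
    then show "?R \<noteq> {}" by (metis empty_iff)
  next
    fix r assume "r \<in> ?R"
    then show "Card_order r" by (elim CollectE exE conjE) (simp add: card_of_Card_order)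
  qed
  then show ?thesis by (elim CollectE exE conjE) (rule that)
qed

lemma top_density_le:
  assumes "D \<subseteq> topspace X" "X closure_of D = topspace X"
  shows "top_density X \<le>o |D|"
  unfolding top_density_def
proof (rule least_card(2))
  let ?R = "{|D| |D. D \<subseteq> topspace X \<and> X closure_of D = topspace X}"
  show "|D| \<in> ?R" using assms by (intro CollectI exI[of _ D] conjI refl)
  then show "?R \<noteq> {}" by (metis empty_iff)
  fix r assume "r \<in> ?R"
  then show "Card_order r" by (elim CollectE exE conjE) (simp add: card_of_Card_order)
qed

lemma Card_order_top_density: "Card_order (top_density X)"
proof -
  obtain D where "top_density X = |D|" using top_density_attained[of X] .
  then show ?thesis by (simp only: card_of_Card_order)
qed

lemma weak_weight_attained:
  fixes X :: "'b topology"
  assumes "tychonoff_space X"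
  obtains Y :: "'b topology" and \<phi> where "tychonoff_space Y" "continuous_map X Y \<phi>"
    "bij_betw \<phi> (topspace X) (topspace Y)" "weak_weight X = weight Y"
proof -
  let ?R = "{weight Y |Y :: 'b topology. tychonoff_space Y \<and>
     (\<exists>\<phi>. continuous_map X Y \<phi> \<and> bij_betw \<phi> (topspace X) (topspace Y))}"
  have "weak_weight X \<in> ?R"
    unfolding weak_weight_def
  proof (rule least_card(1))
    have "weight X \<in> ?R"
      using assms by (intro CollectI exI[of _ X] conjI refl exI[of _ id]) auto
    then show "?R \<noteq> {}" by blast
  next
    fix r assume "r \<in> ?R"
    then show "Card_order r" by (elim CollectE exE conjE) (simp add: card_order_weight)
  qed
  then show ?thesis using that by blast
qed

lemma tychonoff_space_euclidean: "tychonoff_space (euclidean :: 'a::metric_space topology)"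
  by (simp add: tychonoff_space_def metrizable_imp_completely_regular_space
      metrizable_space_euclidean)

lemma Card_order_weak_weight: "tychonoff_space X \<Longrightarrow> Card_order (weak_weight X)"
  using weak_weight_attained[of X] card_order_weight by metis

text \<open>
  The identity is a continuous bijection of a metric space onto itself, so it suffices to bound the
  weight, for which the balls of radius \<open>1/(n+1)\<close> around the points of a dense set are enough.
\<close>
lemma weak_weight_le_density:
  "weak_weight (euclidean :: 'a::metric_space topology)
     \<le>o top_density (euclidean :: 'a topology) +c natLeq" (is "_ \<le>o ?r")
proof -
  obtain D :: "'a set" where D: "closure D = UNIV" "top_density (euclidean :: 'a topology) = |D|"
    by (metis top_density_attained euclidean_closure_of topspace_euclidean)
  let ?B = "(\<lambda>(x, n). ball x (inverse (real (Suc n)))) ` (D \<times> (UNIV :: nat set))"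
  have "is_base euclidean ?B"
    unfolding is_base_def
  proof (intro conjI allI impI)
    show "\<forall>V\<in>?B. openin euclidean V" by auto
  next
    fix U :: "'a set" and x assume "openin euclidean U \<and> x \<in> U"
    then obtain \<epsilon> where \<epsilon>: "\<epsilon> > 0" "ball x \<epsilon> \<subseteq> U"
      by (metis open_contains_ball open_openin)
    obtain n where n: "inverse (real (Suc n)) < \<epsilon> / 2"
      using reals_Archimedean[of "\<epsilon> / 2"] \<epsilon> by auto
    let ?d = "inverse (real (Suc n))"
    have "x \<in> closure D" using D by simp
    then obtain y where y: "y \<in> D" "dist y x < ?d"
      unfolding closure_approachable using inverse_Suc by blast
    have "ball y ?d \<subseteq> ball x \<epsilon>"
    proof
      fix z assume "z \<in> ball y ?d"
      then have "dist x z < ?d + ?d"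
        using y dist_triangle[of x z y] by (simp add: dist_commute)
      then show "z \<in> ball x \<epsilon>" using n by simp
    qed
    moreover have "x \<in> ball y ?d" using y by simp
    ultimately show "\<exists>V\<in>?B. x \<in> V \<and> V \<subseteq> U"
      using y(1) \<epsilon>(2) by (intro bexI[of _ "ball y ?d"]) auto
  qed
  then have "weight (euclidean :: 'a topology) \<le>o |?B|" by (rule weight_le)
  also have "|?B| \<le>o ?r"
  proof (intro image_ordLeq Times_Cinfinite_bound Cinfinite_csum_natLeq)
    show "|D| \<le>o ?r" unfolding D(2) by (intro ordLeq_csum1 card_of_Card_order)
    show "|UNIV :: nat set| \<le>o ?r"
      by (intro countable_ordLeq_Cinfinite Cinfinite_csum_natLeq) auto
  qed
  finally have "weight (euclidean :: 'a topology) \<le>o ?r" .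
  moreover have "weak_weight (euclidean :: 'a topology) \<le>o weight (euclidean :: 'a topology)"
    by (rule weak_weight_le[of _ _ id]) (auto simp: tychonoff_space_euclidean)
  ultimately show ?thesis by (rule ordLeq_transitive[rotated])
qed

section \<open>Point-separating families and coarser Tychonoff topologies\<close>

definition separates_points :: "('a \<Rightarrow> real) set \<Rightarrow> bool" where
  "separates_points D \<longleftrightarrow> (\<forall>x y. x \<noteq> y \<longrightarrow> (\<exists>d\<in>D. d x \<noteq> d y))"

text \<open>
  The witness is the topology generated by the preimages under \<open>D\<close> of a countable base of the real
  line. It is Hausdorff because \<open>D\<close> separates points, and its members, as finite intersections and
  unions of such preimages, inherit the separating functions that each preimage has.
\<close>
lemma weak_weight_le_separating:
  fixes X :: "'a topology" and D :: "('a \<Rightarrow> real) set"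
  assumes X: "topspace X = UNIV" and cont: "\<And>d. d \<in> D \<Longrightarrow> continuous_map X euclideanreal d"
    and sep: "separates_points D" and D: "|D| \<le>o r" and r: "Cinfinite r"
  shows "weak_weight X \<le>o r"
proof -
  obtain B0 :: "real set set" where B0: "countable B0" "topological_basis B0"
    using ex_countable_basis by blast
  \<comment> \<open>\<open>UNIV\<close> makes the whole type the carrier even when \<open>D\<close> is empty and \<open>X\<close> is a single point.\<close>
  define S where "S = insert UNIV ((\<lambda>(d, V). d -` V) ` (D \<times> B0))"
  define Y where "Y = topology_generated_by S"
  have Yt: "topspace Y = UNIV" by (auto simp: Y_def S_def)
  have Yd: "continuous_map Y euclideanreal d" if d: "d \<in> D" for d
  proof -
    have "openin Y (d -` U)" if "open U" for U
    proof -
      obtain B' where B': "B' \<subseteq> B0" "\<Union>B' = U"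
        using B0(2) \<open>open U\<close> unfolding topological_basis_def by blast
      have "openin Y (\<Union>V\<in>B'. d -` V)"
      proof (intro openin_Union ballI)
        fix W assume "W \<in> (\<lambda>V. d -` V) ` B'"
        then have "W \<in> S" using B'(1) d by (auto simp: S_def)
        then show "openin Y W" unfolding Y_def by (rule topology_generated_by_Basis)
      qed
      moreover have "(\<Union>V\<in>B'. d -` V) = d -` U" using B'(2) by auto
      ultimately show ?thesis by simp
    qed
    then show ?thesis by (simp add: continuous_map_def Yt vimage_def)
  qed
  \<comment> \<open>The bound on the range is part of the induction: it makes the maximum of two such functions
    equal to 1 wherever one of them is.\<close>
  have "\<exists>f. continuous_map Y euclideanreal f \<and> f x = 0 \<and>
      f ` (topspace Y - U) \<subseteq> {1} \<and> range f \<subseteq> {0..1}"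
    if "openin Y U" "x \<in> U" for U x
  proof -
    have "generate_topology_on S U"
      using that(1) by (simp add: Y_def openin_topology_generated_by_iff)
    then show ?thesis using that(2)
    proof (induction arbitrary: x)
      case Empty
      then show ?case by simp
    next
      case (Int U V)
      from Int.IH(1)[of x] Int.prems obtain f where
        f: "continuous_map Y euclideanreal f" "f x = 0" "f ` (topspace Y - U) \<subseteq> {1}" "range f \<subseteq> {0..1}"
        by auto
      from Int.IH(2)[of x] Int.prems obtain g where
        g: "continuous_map Y euclideanreal g" "g x = 0" "g ` (topspace Y - V) \<subseteq> {1}" "range g \<subseteq> {0..1}"
        by auto
      have b: "0 \<le> f z" "f z \<le> 1" "0 \<le> g z" "g z \<le> 1" for z
        using f(4) g(4) by (auto simp: image_subset_iff)
      have o: "f z = 1" if "z \<notin> U" for z using f(3) that Yt by auto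
      have o': "g z = 1" if "z \<notin> V" for z using g(3) that Yt by auto
      show ?case
      proof (intro exI[of _ "\<lambda>z. max (f z) (g z)"] conjI)
        show "continuous_map Y euclideanreal (\<lambda>z. max (f z) (g z))"
          using f(1) g(1) by (rule continuous_map_real_max)
      qed (use f(2) g(2) b o o' in \<open>auto simp: max_def intro: antisym\<close>)
    next
      case (UN \<U>)
      then obtain U where U: "U \<in> \<U>" "x \<in> U" by blast
      obtain f where "continuous_map Y euclideanreal f" "f x = 0" "f ` (topspace Y - U) \<subseteq> {1}"
        "range f \<subseteq> {0..1}"
        using UN.IH[OF U] by metis
      then show ?case using U(1) by (intro exI[of _ f]) blast
    next
      case (Basis U)
      then consider "U = UNIV" | d V where "d \<in> D" "V \<in> B0" "U = d -` V"
        by (auto simp: S_def)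
      then show ?case
      proof cases
        case 1
        then show ?thesis by (intro exI[of _ "\<lambda>_. 0"]) auto
      next
        case 2
        then have "open V" using B0(2) topological_basis_open by blast
        then obtain \<epsilon> where \<epsilon>: "\<epsilon> > 0" "ball (d x) \<epsilon> \<subseteq> V"
          using Basis.prems 2 by (metis open_contains_ball vimageE)
        show ?thesis
        proof (intro exI[of _ "\<lambda>z. min (\<bar>d z - d x\<bar> / \<epsilon>) 1"] conjI)
          have "continuous_map euclideanreal euclideanreal (\<lambda>t. min (\<bar>t - d x\<bar> / \<epsilon>) 1)"
            using \<epsilon>(1) by (auto intro!: continuous_intros)
          from continuous_map_compose[OF Yd[OF 2(1)] this]
          show "continuous_map Y euclideanreal (\<lambda>z. min (\<bar>d z - d x\<bar> / \<epsilon>) 1)"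
            by (simp add: o_def)
          have "\<epsilon> \<le> \<bar>d z - d x\<bar>" if "z \<notin> U" for z
            using \<epsilon>(2) that 2(3) by (force simp: dist_real_def)
          then show "(\<lambda>z. min (\<bar>d z - d x\<bar> / \<epsilon>) 1) ` (topspace Y - U) \<subseteq> {1}"
            using \<epsilon>(1) by (auto simp: min_def field_simps intro: antisym)
        qed (use \<epsilon>(1) in auto)
      qed
    qed
  qed
  then have "completely_regular_space Y"
    unfolding completely_regular_space_alt' by metis
  moreover have "Hausdorff_space Y"
    unfolding Hausdorff_space_def
  proof (intro allI impI)
    fix x y assume "x \<in> topspace Y \<and> y \<in> topspace Y \<and> x \<noteq> y"
    then obtain d where d: "d \<in> D" "d x \<noteq> d y"
      using sep unfolding separates_points_def by blast
    then obtain U V where UV: "open U" "open V" "d x \<in> U" "d y \<in> V" "U \<inter> V = {}"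
      using separation_t2[of "d x" "d y"] by blast
    have "openin Y (d -` U)" "openin Y (d -` V)"
      using Yd[OF d(1)] UV by (auto simp: continuous_map_def Yt vimage_def)
    then show "\<exists>U V. openin Y U \<and> openin Y V \<and> x \<in> U \<and> y \<in> V \<and> disjnt U V"
      using UV by (intro exI[of _ "d -` U"] exI[of _ "d -` V"]) (auto simp: disjnt_def)
  qed
  ultimately have Y: "tychonoff_space Y" by (simp add: tychonoff_space_def)
  have "|S| \<le>o r"
  proof -
    have "|(\<lambda>(d, V). d -` V) ` (D \<times> B0)| \<le>o r"
      using r by (intro image_ordLeq Times_Cinfinite_bound D countable_ordLeq_Cinfinite B0)
    moreover have "|{UNIV :: 'a set}| \<le>o r"
      using r by (intro countable_ordLeq_Cinfinite) auto
    ultimately have "|{UNIV} \<union> (\<lambda>(d, V). d -` V) ` (D \<times> B0)| \<le>o r"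
      using r by (intro Un_Cinfinite_bound)
    then show ?thesis by (simp add: S_def)
  qed
  moreover have "countable {(\<inter>) :: 'a set \<Rightarrow> _}" by simp
  ultimately obtain \<B> where \<B>: "S \<subseteq> \<B>"
    "\<And>p U V. p \<in> {(\<inter>)} \<Longrightarrow> U \<in> \<B> \<Longrightarrow> V \<in> \<B> \<Longrightarrow> p U V \<in> \<B>" "|\<B>| \<le>o r"
    "\<And>B. S \<subseteq> B \<Longrightarrow> (\<And>p U V. p \<in> {(\<inter>)} \<Longrightarrow> U \<in> B \<Longrightarrow> V \<in> B \<Longrightarrow> p U V \<in> B) \<Longrightarrow> \<B> \<subseteq> B"
    using exists_operation_closed_superset[OF r, of S "{(\<inter>)}"] by blast
  have "is_base Y \<B>"
    unfolding is_base_def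
  proof (intro conjI allI impI)
    have "\<B> \<subseteq> {U. openin Y U}"
      by (rule \<B>(4)) (auto simp: Y_def topology_generated_by_Basis)
    then show "\<forall>V\<in>\<B>. openin Y V" by blast
  next
    fix U x assume "openin Y U \<and> x \<in> U"
    then have "generate_topology_on S U" "x \<in> U"
      by (simp_all add: Y_def openin_topology_generated_by_iff)
    then show "\<exists>V\<in>\<B>. x \<in> V \<and> V \<subseteq> U"
    proof (induction arbitrary: x)
      case Empty
      then show ?case by simp
    next
      case (Int U V)
      obtain U' V' where "U' \<in> \<B>" "x \<in> U'" "U' \<subseteq> U" "V' \<in> \<B>" "x \<in> V'" "V' \<subseteq> V"
        using Int.IH[of x] Int.prems by blast
      then show ?case using \<B>(2) by (intro bexI[of _ "U' \<inter> V'"]) auto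
    next
      case (UN \<U>)
      then show ?case by (meson UnionE Union_upper order_trans)
    next
      case (Basis U)
      then show ?case using \<B>(1) by blast
    qed
  qed
  then have "weight Y \<le>o |\<B>|" by (rule weight_le)
  then have wY: "weight Y \<le>o r" using \<B>(3) ordLeq_transitive by metis
  have "continuous_map X Y id"
    unfolding Y_def
  proof (rule continuous_on_generated_topo)
    fix U assume "U \<in> S"
    then show "openin X (id -` U \<inter> topspace X)"
      using cont openin_topspace[of X] topological_basis_open[OF B0(2)]
      by (auto simp: S_def X continuous_map_def vimage_def)
  qed (auto simp: S_def)
  then have "weak_weight X \<le>o weight Y"
    by (intro weak_weight_le[OF Y]) (auto simp: X Yt)
  then show ?thesis using wY ordLeq_transitive by metis
qed

text \<open>
  For each pair \<open>(U, V)\<close> of basic open sets of the coarser space choose one function that is smaller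
  on \<open>U\<close> than on \<open>V\<close>, if there is any. For distinct points, a function from complete regularity
  lies below 1/2 near one and above 1/2 near the other, which gives a pair where the choice succeeds.
\<close>
lemma separating_family_of_weak_weight:
  fixes X :: "'a topology"
  assumes X: "topspace X = UNIV" "tychonoff_space X" and w: "weak_weight X \<le>o r" and r: "Cinfinite r"
  obtains F where "|F| \<le>o r" "separates_points F"
    "\<And>h. h \<in> F \<Longrightarrow> continuous_map X euclideanreal h \<and> range h \<subseteq> {0..1}"
proof -
  obtain Y \<phi> where Y: "tychonoff_space Y" "continuous_map X Y \<phi>"
    "bij_betw \<phi> (topspace X) (topspace Y)" "weak_weight X = weight Y"
    using weak_weight_attained[OF X(2)] by metis
  obtain \<B> where \<B>: "is_base Y \<B>" "weight Y = |\<B>|" using weight_attained by blast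
  have \<B>r: "|\<B>| \<le>o r" using w Y(4) \<B>(2) by simp
  define good where "good = (\<lambda>(U, V) h. continuous_map X euclideanreal h \<and> range h \<subseteq> {0..1::real} \<and>
      (\<forall>x y. \<phi> x \<in> U \<longrightarrow> \<phi> y \<in> V \<longrightarrow> h x < h y))"
  define F where "F = (\<lambda>p. SOME h. good p h) ` {p \<in> \<B> \<times> \<B>. \<exists>h. good p h}"
  show ?thesis
  proof
    have "|{p \<in> \<B> \<times> \<B>. \<exists>h. good p h}| \<le>o |\<B> \<times> \<B>|" by (rule card_of_mono1) (rule Collect_restrict)
    also have "|\<B> \<times> \<B>| \<le>o r" using \<B>r r by (intro Times_Cinfinite_bound)
    finally show "|F| \<le>o r" unfolding F_def by (rule image_ordLeq)
  next
    fix h assume "h \<in> F"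
    then obtain p where "\<exists>h. good p h" "h = (SOME h. good p h)" unfolding F_def by blast
    then have "good p h" using someI_ex by metis
    then show "continuous_map X euclideanreal h \<and> range h \<subseteq> {0..1}"
      by (cases p) (simp add: good_def)
  next
    show "separates_points F"
      unfolding separates_points_def
    proof (intro allI impI)
      fix x y :: 'a assume "x \<noteq> y"
      then have ne: "\<phi> x \<noteq> \<phi> y" and t: "\<phi> x \<in> topspace Y" "\<phi> y \<in> topspace Y"
        using Y(3) X(1) by (auto simp: bij_betw_def inj_on_def)
      have "closedin Y {\<phi> y}"
        using Y(1) t by (simp add: tychonoff_space_def closedin_Hausdorff_singleton)
      then obtain g where g: "continuous_map Y (top_of_set {0..1::real}) g" "g (\<phi> x) = 0" "g (\<phi> y) = 1"
        using Y(1) t ne unfolding tychonoff_space_def completely_regular_space_def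
        by (metis DiffI image_insert insert_subset singletonD)
      have gc: "continuous_map Y euclideanreal g"
        using g(1) continuous_map_into_fulltopology by blast
      have "openin Y {z \<in> topspace Y. g z \<in> {..<1/2}}" "openin Y {z \<in> topspace Y. g z \<in> {1/2<..}}"
        using gc by (intro openin_continuous_map_preimage[where Y=euclideanreal]; simp)+
      then obtain U V where UV: "U \<in> \<B>" "\<phi> x \<in> U" "U \<subseteq> {z \<in> topspace Y. g z \<in> {..<1/2}}"
        "V \<in> \<B>" "\<phi> y \<in> V" "V \<subseteq> {z \<in> topspace Y. g z \<in> {1/2<..}}"
        using \<B>(1) t g(2,3) unfolding is_base_def
        by (smt (verit, best) greaterThan_iff half_gt_zero_iff lessThan_iff mem_Collect_eq field_sum_of_halves)
      have "good (U, V) (g \<circ> \<phi>)"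
        unfolding good_def
      proof (clarify, intro conjI allI impI)
        show "continuous_map X euclideanreal (g \<circ> \<phi>)" using Y(2) gc by (rule continuous_map_compose)
        show "range (g \<circ> \<phi>) \<subseteq> {0..1}"
          using g(1) Y(3) X(1) by (auto simp: continuous_map_in_subtopology bij_betw_def)
      next
        fix a b assume "\<phi> a \<in> U" "\<phi> b \<in> V"
        then show "(g \<circ> \<phi>) a < (g \<circ> \<phi>) b" using UV by force
      qed
      then have ex: "\<exists>h. good (U, V) h" by blast
      then have "good (U, V) (SOME h. good (U, V) h)" by (rule someI_ex)
      then have "(SOME h. good (U, V) h) x < (SOME h. good (U, V) h) y"
        using UV by (simp add: good_def)
      moreover have "(SOME h. good (U, V) h) \<in> F" using ex UV by (auto simp: F_def)
      ultimately show "\<exists>d\<in>F. d x \<noteq> d y" by (metis less_irrefl)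
    qed
  qed
qed

section \<open>Lipschitz minorants\<close>

text \<open>
  For \<open>f\<close> bounded below this is the Pasch-Hausdorff envelope of \<open>f\<close>: the largest \<open>n\<close>-Lipschitz
  function below \<open>f\<close>.
\<close>
definition lipschitz_minorant :: "nat \<Rightarrow> ('a::metric_space \<Rightarrow> real) \<Rightarrow> 'a \<Rightarrow> real" where
  "lipschitz_minorant n f x = (INF y. f y + real n * dist x y)"

lemma lipschitz_minorant_lower:
  assumes "\<And>y. 0 \<le> f y"
  shows "lipschitz_minorant n f x \<le> f y + real n * dist x y"
  unfolding lipschitz_minorant_def
  by (intro cINF_lower bdd_belowI[of _ 0]) (use assms in auto)

lemma lipschitz_minorant_greatest:
  assumes "\<And>y. c \<le> f y + real n * dist x y"
  shows "c \<le> lipschitz_minorant n f x"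
  unfolding lipschitz_minorant_def by (intro cINF_greatest) (use assms in auto)

lemma lipschitz_minorant_lipschitz:
  fixes f :: "'a::metric_space \<Rightarrow> real"
  assumes "\<And>y. 0 \<le> f y"
  shows "(real n)-lipschitz_on UNIV (lipschitz_minorant n f)"
proof (rule lipschitz_onI)
  fix x y :: 'a
  have *: "lipschitz_minorant n f x \<le> lipschitz_minorant n f y + real n * dist x y" for x y
  proof -
    have "lipschitz_minorant n f x - real n * dist x y \<le> f z + real n * dist y z" for z
    proof -
      have "real n * dist x z \<le> real n * (dist x y + dist y z)"
        by (intro mult_left_mono dist_triangle) auto
      then show ?thesis
        using lipschitz_minorant_lower[of f n x z] assms by (simp add: algebra_simps)
    qed
    then have "lipschitz_minorant n f x - real n * dist x y \<le> lipschitz_minorant n f y"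
      by (rule lipschitz_minorant_greatest)
    then show ?thesis by simp
  qed
  show "dist (lipschitz_minorant n f x) (lipschitz_minorant n f y) \<le> real n * dist x y"
    using *[of x y] *[of y x] by (simp add: dist_real_def dist_commute abs_le_iff)
qed simp

lemma lipschitz_minorant_in_Lip:
  fixes f :: "'a::metric_space \<Rightarrow> real"
  assumes "range f \<subseteq> {0..1}"
  shows "lipschitz_minorant n f \<in> Lip"
proof -
  have f: "0 \<le> f y" "f y \<le> 1" for y using assms by (auto simp: image_subset_iff)
  have "0 \<le> lipschitz_minorant n f x" for x
    by (rule lipschitz_minorant_greatest) (use f in auto)
  moreover have "lipschitz_minorant n f x \<le> 1" for x
    using lipschitz_minorant_lower[of f n x x] f[of x] f(1) by simp
  ultimately have "range (lipschitz_minorant n f) \<subseteq> {0..1}" by auto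
  then have "bounded (range (lipschitz_minorant n f))"
    using bounded_closed_interval bounded_subset by blast
  then show ?thesis
    using lipschitz_minorant_lipschitz[of f n] f(1) unfolding Lip_def LIP_def by blast
qed

text \<open>
  All minorants are at most \<open>f x\<close> at \<open>x\<close>, while at \<open>y\<close> they eventually exceed any number \<open>c < f y\<close>:
  near \<open>y\<close> the values of \<open>f\<close> are above \<open>c\<close>, and farther away the penalty \<open>n * dist y z\<close> is.
\<close>
lemma lipschitz_minorants_separate:
  fixes f :: "'a::metric_space \<Rightarrow> real"
  assumes cont: "continuous_on UNIV f" and nonneg: "\<And>z. 0 \<le> f z" and less: "f x < f y"
  shows "\<exists>n. lipschitz_minorant n f x < lipschitz_minorant n f y"
proof -
  define c where "c = (f x + f y) / 2"
  have c: "f x < c" "c < f y" using less by (auto simp: c_def)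
  have "open (f -` {c<..})" using cont by (intro open_vimage) auto
  then obtain \<delta> where \<delta>: "\<delta> > 0" "ball y \<delta> \<subseteq> f -` {c<..}"
    using c open_contains_ball by (metis greaterThan_iff vimageI)
  obtain n where n: "c / \<delta> \<le> real n" using real_arch_simple by blast
  have "c \<le> f z + real n * dist y z" for z
  proof (cases "dist y z < \<delta>")
    case True
    then have "c < f z" using \<delta>(2) by auto
    then show ?thesis by (smt (verit) mult_nonneg_nonneg of_nat_0_le_iff zero_le_dist)
  next
    case False
    have "c \<le> real n * \<delta>" using n \<delta>(1) by (simp add: pos_divide_le_eq)
    also have "\<dots> \<le> real n * dist y z" using False by (intro mult_left_mono) auto
    finally show ?thesis using nonneg[of z] by simp
  qed
  then have "c \<le> lipschitz_minorant n f y" by (rule lipschitz_minorant_greatest)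
  moreover have "lipschitz_minorant n f x \<le> f x"
    using lipschitz_minorant_lower[of f n x x] nonneg by simp
  ultimately show ?thesis using c by (intro exI[of _ n]) simp
qed

section \<open>Spaces of Lipschitz functions\<close>

lemma LIP_subset_C_fun: "LIP \<subseteq> C_fun"
  using lipschitz_on_continuous_on by (auto simp: LIP_def C_fun_def)

lemma Lip_subset_LIP: "Lip \<subseteq> LIP"
  by (auto simp: Lip_def)

lemma Lip0_subset_LIP: "Lip0 e \<subseteq> LIP"
  by (auto simp: Lip0_def)

lemma const_in_Lip: "(\<lambda>_. c) \<in> Lip"
  using lipschitz_on_constant by (auto simp: Lip_def LIP_def)

lemma Lip_add:
  assumes "f \<in> Lip" "g \<in> Lip"
  shows "(\<lambda>x. f x + g x) \<in> Lip"
  using assms lipschitz_on_add bounded_plus_comp[of f UNIV g] unfolding Lip_def LIP_def by blast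

lemma Lip_mult:
  fixes f g :: "'a::metric_space \<Rightarrow> real"
  assumes "f \<in> Lip" "g \<in> Lip"
  shows "(\<lambda>x. f x * g x) \<in> Lip"
proof -
  obtain L M where L: "L-lipschitz_on UNIV f" and M: "M-lipschitz_on UNIV g"
    using assms by (auto simp: Lip_def LIP_def)
  obtain a b where a: "\<And>x. \<bar>f x\<bar> \<le> a" and b: "\<And>x. \<bar>g x\<bar> \<le> b"
    using assms by (auto simp: Lip_def bounded_iff)
  have nn: "0 \<le> L" "0 \<le> M" "0 \<le> a" "0 \<le> b"
    using lipschitz_on_nonneg[OF L] lipschitz_on_nonneg[OF M] a b
    by (auto intro: order_trans[OF abs_ge_zero])
  have "(a * M + L * b)-lipschitz_on UNIV (\<lambda>x. f x * g x)"
  proof (rule lipschitz_onI)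
    fix x y :: 'a
    have "\<bar>f x * g x - f y * g y\<bar> = \<bar>f x * (g x - g y) + (f x - f y) * g y\<bar>"
      by (simp add: algebra_simps)
    also have "\<dots> \<le> \<bar>f x\<bar> * \<bar>g x - g y\<bar> + \<bar>f x - f y\<bar> * \<bar>g y\<bar>"
      by (metis abs_triangle_ineq abs_mult)
    also have "\<dots> \<le> a * (M * dist x y) + (L * dist x y) * b"
      using lipschitz_onD[OF L, of x y] lipschitz_onD[OF M, of x y] a[of x] b[of y] nn
      by (intro add_mono mult_mono) (auto simp: dist_real_def)
    finally show "dist (f x * g x) (f y * g y) \<le> (a * M + L * b) * dist x y"
      by (simp add: dist_real_def algebra_simps)
  qed (use nn in auto)
  moreover have "bounded (range (\<lambda>x. f x * g x))"
    unfolding bounded_iff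
    using mult_mono[OF a b nn(3) abs_ge_zero] by (auto simp: abs_mult)
  ultimately show ?thesis unfolding Lip_def LIP_def by blast
qed

lemma subtract_value_in_Lip0:
  assumes "f \<in> LIP"
  shows "(\<lambda>x. f x - f e) \<in> Lip0 e"
  using assms lipschitz_on_diff[OF _ lipschitz_on_constant] unfolding Lip0_def LIP_def by fastforce

lemma cmult_dist_in_Lip0: "(\<lambda>x. c * dist x e) \<in> Lip0 e"
proof -
  have "1-lipschitz_on UNIV (\<lambda>x. dist x e)"
    by (rule lipschitz_onI) (auto simp: dist_real_def abs_le_iff algebra_simps dist_triangle dist_commute
        dist_triangle2 dist_triangle3)
  from lipschitz_on_cmult_real[OF this, of c] show ?thesis by (auto simp: Lip0_def LIP_def)
qed

lemma separates_points_mono: "separates_points A \<Longrightarrow> A \<subseteq> B \<Longrightarrow> separates_points B"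
  unfolding separates_points_def by blast

text \<open>The truncated distance \<open>min 1 (dist z x)\<close> separates \<open>x\<close> from all other points.\<close>
lemma separates_points_Lip: "separates_points (Lip :: ('a::metric_space \<Rightarrow> real) set)"
  unfolding separates_points_def
proof (intro allI impI)
  fix x y :: 'a assume "x \<noteq> y"
  let ?d = "\<lambda>z. min 1 (dist z x)"
  have "1-lipschitz_on UNIV ?d"
  proof (rule lipschitz_onI)
    fix a b
    show "dist (?d a) (?d b) \<le> 1 * dist a b"
      using dist_triangle[of a x b] dist_triangle[of b x a]
      by (simp add: dist_real_def dist_commute min_def abs_le_iff)
  qed simp
  moreover have "bounded (range ?d)"
    by (rule bounded_subset[OF bounded_closed_interval[of 0 1]]) auto
  ultimately have "?d \<in> Lip" by (auto simp: Lip_def LIP_def)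
  moreover have "?d x \<noteq> ?d y" using \<open>x \<noteq> y\<close> by (simp add: min_def)
  ultimately show "\<exists>f\<in>Lip. f x \<noteq> f y" by (intro bexI[of _ ?d])
qed

lemma separates_points_Lip0: "separates_points (Lip0 (e :: 'a::metric_space))"
  unfolding separates_points_def
proof (intro allI impI)
  fix x y :: 'a assume "x \<noteq> y"
  then obtain f where f: "f \<in> Lip" "f x \<noteq> f y"
    using separates_points_Lip unfolding separates_points_def by blast
  then have "(\<lambda>z. f z - f e) \<in> Lip0 e" using Lip_subset_LIP subtract_value_in_Lip0 by blast
  then show "\<exists>f\<in>Lip0 e. f x \<noteq> f y"
    by (rule rev_bexI) (use f(2) in simp)
qed

section \<open>Uniform approximation on compact sets\<close>

text \<open>
  The usual theorem asks for all real constants, which would make the approximating set at least as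
  large as the continuum. It is applied here to the uniform closure \<open>R\<close> of \<open>A\<close> on \<open>K\<close>, which contains
  the real constants and is again closed under sums and products.
\<close>
lemma Stone_Weierstrass_rational_constants:
  fixes A :: "('a::t2_space \<Rightarrow> real) set"
  assumes K: "compact K" and cont: "\<And>g. g \<in> A \<Longrightarrow> continuous_on K g"
    and add: "\<And>f g. f \<in> A \<Longrightarrow> g \<in> A \<Longrightarrow> (\<lambda>x. f x + g x) \<in> A"
    and mult: "\<And>f g. f \<in> A \<Longrightarrow> g \<in> A \<Longrightarrow> (\<lambda>x. f x * g x) \<in> A"
    and const: "\<And>q. (\<lambda>_. real_of_rat q) \<in> A"
    and sep: "separates_points A"
    and f: "continuous_on K f" and \<epsilon>: "\<epsilon> > 0"
  shows "\<exists>g\<in>A. \<forall>x\<in>K. \<bar>f x - g x\<bar> < \<epsilon>"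
proof -
  define R where "R = {f. continuous_on K f \<and> (\<forall>\<epsilon>>0. \<exists>g\<in>A. \<forall>x\<in>K. \<bar>f x - g x\<bar> < \<epsilon>)}"
  have RD: "\<exists>g\<in>A. \<forall>x\<in>K. \<bar>f x - g x\<bar> < \<epsilon>" if "f \<in> R" "\<epsilon> > 0" for f \<epsilon>
    using that by (auto simp: R_def)
  have A_R: "A \<subseteq> R"
    unfolding R_def using cont by (auto intro!: bexI)
  interpret function_ring_on R K
  proof
    show "compact K" by (rule K)
    show "continuous_on K f" if "f \<in> R" for f using that by (simp add: R_def)
  next
    fix f g assume fg: "f \<in> R" "g \<in> R"
    show "(\<lambda>x. f x + g x) \<in> R"
      unfolding R_def
    proof (intro CollectI conjI allI impI)
      show "continuous_on K (\<lambda>x. f x + g x)"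
        using fg by (auto simp: R_def intro!: continuous_intros)
      fix \<epsilon> :: real assume "\<epsilon> > 0"
      then obtain f' g' where a: "f' \<in> A" "g' \<in> A" "\<forall>x\<in>K. \<bar>f x - f' x\<bar> < \<epsilon>/2" "\<forall>x\<in>K. \<bar>g x - g' x\<bar> < \<epsilon>/2"
        using RD[OF fg(1), of "\<epsilon>/2"] RD[OF fg(2), of "\<epsilon>/2"] by auto
      show "\<exists>h\<in>A. \<forall>x\<in>K. \<bar>f x + g x - h x\<bar> < \<epsilon>"
      proof (intro bexI[OF _ add[OF a(1,2)]] ballI)
        fix x assume "x \<in> K"
        then have "\<bar>f x - f' x\<bar> < \<epsilon>/2" "\<bar>g x - g' x\<bar> < \<epsilon>/2" using a by auto
        then show "\<bar>f x + g x - (f' x + g' x)\<bar> < \<epsilon>" by linarith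
      qed
    qed
    show "(\<lambda>x. f x * g x) \<in> R"
      unfolding R_def
    proof (intro CollectI conjI allI impI)
      have c: "continuous_on K f" "continuous_on K g" using fg by (auto simp: R_def)
      then show "continuous_on K (\<lambda>x. f x * g x)" by (intro continuous_intros)
      fix \<epsilon> :: real assume \<epsilon>: "\<epsilon> > 0"
      obtain M N where M: "0 < M" "\<And>x. x \<in> K \<Longrightarrow> \<bar>f x\<bar> \<le> M" and N: "0 < N" "\<And>x. x \<in> K \<Longrightarrow> \<bar>g x\<bar> \<le> N"
        using compact_imp_bounded[OF compact_continuous_image[OF c(1) K]]
          compact_imp_bounded[OF compact_continuous_image[OF c(2) K]]
        unfolding bounded_pos by auto
      \<comment> \<open>Products are off by at most \<open>M \<delta> + \<delta> (N + \<delta>)\<close>, and \<open>\<delta> \<le> 1\<close>.\<close>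
      define \<delta> where "\<delta> = min 1 (\<epsilon> / (2 * (M + N + 1)))"
      have \<delta>: "0 < \<delta>" "\<delta> \<le> 1" using \<epsilon> M N by (auto simp: \<delta>_def)
      have "\<delta> \<le> \<epsilon> / (2 * (M + N + 1))" by (simp add: \<delta>_def)
      then have \<delta>': "(M + N + 1) * \<delta> \<le> \<epsilon> / 2" using M N by (simp add: field_simps)
      obtain f' g' where a: "f' \<in> A" "g' \<in> A" "\<forall>x\<in>K. \<bar>f x - f' x\<bar> < \<delta>" "\<forall>x\<in>K. \<bar>g x - g' x\<bar> < \<delta>"
        using RD[OF fg(1) \<delta>(1)] RD[OF fg(2) \<delta>(1)] by auto
      show "\<exists>h\<in>A. \<forall>x\<in>K. \<bar>f x * g x - h x\<bar> < \<epsilon>"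
      proof (intro bexI[OF _ mult[OF a(1,2)]] ballI)
        fix x assume x: "x \<in> K"
        then have b: "\<bar>f x - f' x\<bar> < \<delta>" "\<bar>g x - g' x\<bar> < \<delta>" using a by auto
        have "\<bar>g' x\<bar> \<le> N + 1" using b(2) N(2)[OF x] \<delta>(2) by linarith
        have "\<bar>f x * g x - f' x * g' x\<bar> = \<bar>f x * (g x - g' x) + (f x - f' x) * g' x\<bar>"
          by (simp add: algebra_simps)
        also have "\<dots> \<le> \<bar>f x\<bar> * \<bar>g x - g' x\<bar> + \<bar>f x - f' x\<bar> * \<bar>g' x\<bar>"
          by (metis abs_triangle_ineq abs_mult)
        also have "\<dots> \<le> M * \<delta> + \<delta> * (N + 1)"
          using M b \<delta>(1) x \<open>\<bar>g' x\<bar> \<le> N + 1\<close> by (intro add_mono mult_mono) auto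
        also have "\<dots> = (M + N + 1) * \<delta>" by (simp add: algebra_simps)
        also have "\<dots> < \<epsilon>" using \<delta>' \<epsilon> by linarith
        finally show "\<bar>f x * g x - f' x * g' x\<bar> < \<epsilon>" .
      qed
    qed
  next
    fix c :: real
    have "\<exists>g\<in>A. \<forall>x\<in>K. \<bar>c - g x\<bar> < \<epsilon>" if "\<epsilon> > 0" for \<epsilon>
    proof -
      obtain q where "c - \<epsilon> < real_of_rat q" "real_of_rat q < c + \<epsilon>"
        using of_rat_dense[of "c - \<epsilon>" "c + \<epsilon>"] \<open>\<epsilon> > 0\<close> by auto
      then show ?thesis by (intro bexI[OF _ const[of q]]) auto
    qed
    then show "(\<lambda>_. c) \<in> R" by (auto simp: R_def)
  next
    fix x y :: 'a assume "x \<noteq> y"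
    then show "\<exists>f\<in>R. f x \<noteq> f y" using sep A_R unfolding separates_points_def by blast
  qed
  obtain g where g: "g \<in> R" "\<forall>x\<in>K. \<bar>f x - g x\<bar> < \<epsilon>/2"
    using Stone_Weierstrass_basic[OF f, of "\<epsilon>/2"] \<epsilon> by auto
  obtain h where h: "h \<in> A" "\<forall>x\<in>K. \<bar>g x - h x\<bar> < \<epsilon>/2"
    using RD[OF g(1), of "\<epsilon>/2"] \<epsilon> by auto
  show ?thesis
  proof (intro bexI[OF _ h(1)] ballI)
    fix x assume "x \<in> K"
    then have "\<bar>f x - g x\<bar> < \<epsilon>/2" "\<bar>g x - h x\<bar> < \<epsilon>/2" using g h by auto
    then show "\<bar>f x - h x\<bar> < \<epsilon>" by linarith
  qed
qed

lemma small_Lip_subset_approximating: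
  assumes w: "weak_weight (euclidean :: 'a::metric_space topology) \<le>o r" and r: "Cinfinite r"
  obtains A :: "('a::metric_space \<Rightarrow> real) set" where "|A| \<le>o r" "A \<subseteq> Lip"
    "\<And>f K \<epsilon>. f \<in> C_fun \<Longrightarrow> compact K \<Longrightarrow> \<epsilon> > 0 \<Longrightarrow> \<exists>g\<in>A. \<forall>x\<in>K. \<bar>f x - g x\<bar> < \<epsilon>"
proof -
  obtain F :: "('a \<Rightarrow> real) set" where F: "|F| \<le>o r" "separates_points F"
    "\<And>h. h \<in> F \<Longrightarrow> continuous_on UNIV h" "\<And>h. h \<in> F \<Longrightarrow> range h \<subseteq> {0..1}"
    using separating_family_of_weak_weight[OF topspace_euclidean tychonoff_space_euclidean w r]
    by (metis continuous_map_iff_continuous2)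
  define F' where "F' = (\<lambda>(n, f). lipschitz_minorant n f) ` ((UNIV :: nat set) \<times> F)"
  have F'_Lip: "F' \<subseteq> Lip"
    unfolding F'_def by (clarify, simp, rule lipschitz_minorant_in_Lip, rule F(4))
  have F'_sep: "separates_points F'"
    unfolding separates_points_def
  proof (intro allI impI)
    fix x y :: 'a assume "x \<noteq> y"
    then obtain f where f: "f \<in> F" "f x \<noteq> f y" using F(2) unfolding separates_points_def by blast
    have nn: "0 \<le> f z" for z using F(4)[OF f(1)] by (auto simp: image_subset_iff)
    have "\<exists>n. lipschitz_minorant n f x \<noteq> lipschitz_minorant n f y"
      using lipschitz_minorants_separate[OF F(3)[OF f(1)] nn] f(2)
      by (metis less_irrefl linorder_neqE_linordered_idom)
    then show "\<exists>d\<in>F'. d x \<noteq> d y" using f(1) by (force simp: F'_def)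
  qed
  define G where "G = F' \<union> range (\<lambda>q (_ :: 'a). real_of_rat q)"
  let ?add = "\<lambda>f g (x :: 'a). f x + g x :: real" and ?mult = "\<lambda>f g (x :: 'a). f x * g x :: real"
  have "|G| \<le>o r"
  proof -
    have "|UNIV :: nat set| \<le>o r" "|UNIV :: rat set| \<le>o r"
      using r by (auto intro!: countable_ordLeq_Cinfinite)
    then show ?thesis
      unfolding G_def F'_def using r F(1)
      by (intro Un_Cinfinite_bound image_ordLeq Times_Cinfinite_bound)
  qed
  moreover have "countable {?add, ?mult}" by simp
  ultimately obtain A where A: "G \<subseteq> A"
    "\<And>p x y. p \<in> {?add, ?mult} \<Longrightarrow> x \<in> A \<Longrightarrow> y \<in> A \<Longrightarrow> p x y \<in> A" "|A| \<le>o r"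
    "\<And>B. G \<subseteq> B \<Longrightarrow> (\<And>p x y. p \<in> {?add, ?mult} \<Longrightarrow> x \<in> B \<Longrightarrow> y \<in> B \<Longrightarrow> p x y \<in> B) \<Longrightarrow> A \<subseteq> B"
    using exists_operation_closed_superset[OF r, of G "{?add, ?mult}"] by blast
  have A_Lip: "A \<subseteq> Lip"
  proof (rule A(4))
    show "G \<subseteq> Lip" using F'_Lip const_in_Lip by (auto simp: G_def)
  next
    fix p and f g :: "'a \<Rightarrow> real"
    assume "p \<in> {?add, ?mult}" and fg: "f \<in> Lip" "g \<in> Lip"
    then consider "p = ?add" | "p = ?mult" by blast
    then show "p f g \<in> Lip"
      by cases (simp_all add: Lip_add[OF fg] Lip_mult[OF fg])
  qed
  show ?thesis
  proof
    show "|A| \<le>o r" "A \<subseteq> Lip" by fact+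
  next
    fix f :: "'a \<Rightarrow> real" and K :: "'a set" and \<epsilon> :: real
    assume f: "f \<in> C_fun" and K: "compact K" and \<epsilon>: "\<epsilon> > 0"
    show "\<exists>g\<in>A. \<forall>x\<in>K. \<bar>f x - g x\<bar> < \<epsilon>"
    proof (rule Stone_Weierstrass_rational_constants[OF K])
      fix g assume "g \<in> A"
      then have "g \<in> C_fun" using A_Lip Lip_subset_LIP LIP_subset_C_fun by blast
      then show "continuous_on K g" by (auto simp: C_fun_def intro: continuous_on_subset)
    next
      show "separates_points A"
        by (rule separates_points_mono[OF F'_sep]) (use A(1) in \<open>auto simp: G_def\<close>)
      show "continuous_on K f" using f by (auto simp: C_fun_def intro: continuous_on_subset)
      show "(\<lambda>_. real_of_rat q) \<in> A" for q using A(1) by (auto simp: G_def)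
    next
      fix f g assume fg: "f \<in> A" "g \<in> A"
      show "(\<lambda>x. f x + g x) \<in> A" using A(2)[OF _ fg, of ?add] by simp
      show "(\<lambda>x. f x * g x) \<in> A" using A(2)[OF _ fg, of ?mult] by simp
    qed (rule \<epsilon>)
  qed
qed

section \<open>Topologies between the pointwise and the compact-open topology\<close>

text \<open>
  The compact-open topology is that of uniform convergence on compact sets: an open set containing
  the compact set \<open>f ` K\<close> contains a uniform neighbourhood of it. This turns uniform approximation on
  compact sets into density.
\<close>
lemma compact_open_neighbourhood:
  fixes f :: "'a::metric_space \<Rightarrow> real"
  assumes "openin compact_open_topology W" "f \<in> W"
  shows "\<exists>K \<epsilon>. compact K \<and> \<epsilon> > 0 \<and> (\<forall>g\<in>C_fun. (\<forall>x\<in>K. \<bar>f x - g x\<bar> < \<epsilon>) \<longrightarrow> g \<in> W)"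
proof -
  let ?S = "{{f \<in> C_fun. f ` K \<subseteq> U} |(K :: 'a set) (U :: real set). compact K \<and> open U}"
  have "generate_topology_on ?S W"
    using assms(1) by (simp add: compact_open_topology_def openin_topology_generated_by_iff)
  then show ?thesis using assms(2)
  proof (induction)
    case Empty
    then show ?case by simp
  next
    case (Int U V)
    then have "f \<in> U" "f \<in> V" by simp_all
    obtain K \<epsilon> where "compact K" "\<epsilon> > 0" "\<forall>g\<in>C_fun. (\<forall>x\<in>K. \<bar>f x - g x\<bar> < \<epsilon>) \<longrightarrow> g \<in> U"
      using Int.IH(1)[OF \<open>f \<in> U\<close>] by (elim exE conjE)
    moreover obtain L \<delta> where "compact L" "\<delta> > 0" "\<forall>g\<in>C_fun. (\<forall>x\<in>L. \<bar>f x - g x\<bar> < \<delta>) \<longrightarrow> g \<in> V"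
      using Int.IH(2)[OF \<open>f \<in> V\<close>] by (elim exE conjE)
    ultimately show ?case
      by (intro exI[of _ "K \<union> L"] exI[of _ "min \<epsilon> \<delta>"]) auto
  next
    case (UN \<U>)
    then obtain U where U: "U \<in> \<U>" "f \<in> U" by blast
    obtain K \<epsilon> where "compact K" "\<epsilon> > 0" "\<forall>g\<in>C_fun. (\<forall>x\<in>K. \<bar>f x - g x\<bar> < \<epsilon>) \<longrightarrow> g \<in> U"
      using UN.IH[OF U] by (elim exE conjE)
    then show ?case using U(1) by (intro exI[of _ K] exI[of _ \<epsilon>]) auto
  next
    case (Basis W)
    then obtain K U where W: "W = {f \<in> C_fun. f ` K \<subseteq> U}" "compact K" "open U" by blast
    then have f: "continuous_on K f" "f ` K \<subseteq> U"
      using Basis.prems by (auto simp: C_fun_def intro: continuous_on_subset)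
    obtain \<epsilon> where \<epsilon>: "\<epsilon> > 0" "(\<Union>t\<in>f ` K. ball t \<epsilon>) \<subseteq> U"
      using compact_subset_open_imp_ball_epsilon_subset[OF compact_continuous_image[OF f(1) W(2)] W(3) f(2)]
      by blast
    show ?case
    proof (intro exI[of _ K] exI[of _ \<epsilon>] conjI ballI impI W(2) \<epsilon>(1))
      fix g assume g: "g \<in> C_fun" "\<forall>x\<in>K. \<bar>f x - g x\<bar> < \<epsilon>"
      have "g x \<in> U" if "x \<in> K" for x
        using \<epsilon>(2) g(2) that by (fastforce simp: dist_real_def)
      then show "g \<in> W" using g(1) W(1) by auto
    qed
  qed
qed

lemma top_density_subspace_le:
  fixes \<tau> :: "('a::metric_space \<Rightarrow> real) topology"
  assumes \<tau>: "topspace \<tau> = C_fun" "\<And>U. openin \<tau> U \<Longrightarrow> openin compact_open_topology U"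
    and sub: "E \<subseteq> A" "A \<subseteq> C_fun"
    and approx: "\<And>f K \<epsilon>. f \<in> A \<Longrightarrow> compact K \<Longrightarrow> \<epsilon> > 0 \<Longrightarrow> \<exists>g\<in>E. \<forall>x\<in>K. \<bar>f x - g x\<bar> < \<epsilon>"
  shows "top_density (subtopology \<tau> A) \<le>o |E|"
proof (rule top_density_le)
  have t: "topspace (subtopology \<tau> A) = A" using \<tau>(1) sub by auto
  show "E \<subseteq> topspace (subtopology \<tau> A)" using t sub by simp
  show "subtopology \<tau> A closure_of E = topspace (subtopology \<tau> A)"
    unfolding dense_intersects_open
  proof (intro allI impI)
    fix T assume "openin (subtopology \<tau> A) T \<and> T \<noteq> {}"
    then obtain W f where W: "openin \<tau> W" "T = W \<inter> A" "f \<in> W" "f \<in> A"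
      by (auto simp: openin_subtopology)
    obtain K \<epsilon> where K: "compact K" "\<epsilon> > 0" "\<forall>g\<in>C_fun. (\<forall>x\<in>K. \<bar>f x - g x\<bar> < \<epsilon>) \<longrightarrow> g \<in> W"
      using compact_open_neighbourhood[OF \<tau>(2)[OF W(1)] W(3)] by blast
    obtain g where "g \<in> E" "\<forall>x\<in>K. \<bar>f x - g x\<bar> < \<epsilon>" using approx[OF W(4) K(1,2)] by blast
    then have "g \<in> E \<inter> T" using K(3) sub W(2) by blast
    then show "E \<inter> T \<noteq> {}" by blast
  qed
qed

lemma openin_evaluation_preimage:
  fixes \<tau> :: "('a::metric_space \<Rightarrow> real) topology"
  assumes \<tau>: "\<And>U. openin pointwise_topology U \<Longrightarrow> openin \<tau> U" and U: "open U"
  shows "openin \<tau> {f \<in> C_fun. f x \<in> U}"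
proof -
  have "continuous_map pointwise_topology euclideanreal (\<lambda>f. f x)"
    unfolding pointwise_topology_def
    by (intro continuous_map_from_subtopology continuous_map_product_projection) simp
  then have "openin pointwise_topology {f \<in> topspace pointwise_topology. f x \<in> U}"
    using U by (intro openin_continuous_map_preimage) auto
  then show ?thesis by (intro \<tau>) (simp add: pointwise_topology_def)
qed

text \<open>
  With disjoint \<open>U\<close> and \<open>V\<close> this yields members of \<open>D\<close> that separate \<open>x\<close> and \<open>y\<close>; with \<open>y = x\<close> and
  \<open>V = UNIV\<close> it yields members with large values at \<open>x\<close>.
\<close>
lemma dense_meets_evaluation_conditions:
  fixes \<tau> :: "('a::metric_space \<Rightarrow> real) topology"
  assumes \<tau>: "\<And>U. openin pointwise_topology U \<Longrightarrow> openin \<tau> U"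
    and A: "A \<subseteq> C_fun" "f \<in> A" and D: "subtopology \<tau> A closure_of D = topspace (subtopology \<tau> A)"
    and UV: "open U" "open V" "f x \<in> U" "f y \<in> V"
  shows "\<exists>d\<in>D. d x \<in> U \<and> d y \<in> V"
proof -
  have "openin \<tau> ({g \<in> C_fun. g x \<in> U} \<inter> {g \<in> C_fun. g y \<in> V})"
    using UV \<tau> by (intro openin_Int openin_evaluation_preimage)
  then have "openin (subtopology \<tau> A) (A \<inter> ({g \<in> C_fun. g x \<in> U} \<inter> {g \<in> C_fun. g y \<in> V}))"
    by (rule openin_subtopology_Int2)
  moreover have "f \<in> A \<inter> ({g \<in> C_fun. g x \<in> U} \<inter> {g \<in> C_fun. g y \<in> V})" using A UV by auto
  ultimately show ?thesis using D unfolding dense_intersects_open by blast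
qed

lemma weak_weight_le_density_subspace:
  fixes \<tau> :: "('a::metric_space \<Rightarrow> real) topology"
  assumes \<tau>: "topspace \<tau> = C_fun" "\<And>U. openin pointwise_topology U \<Longrightarrow> openin \<tau> U"
    and A: "A \<subseteq> C_fun" "separates_points A"
  shows "weak_weight (euclidean :: 'a topology) \<le>o top_density (subtopology \<tau> A) +c natLeq"
proof -
  obtain D where D: "D \<subseteq> topspace (subtopology \<tau> A)"
    "subtopology \<tau> A closure_of D = topspace (subtopology \<tau> A)" "top_density (subtopology \<tau> A) = |D|"
    using top_density_attained by metis
  show ?thesis
  proof (rule weak_weight_le_separating)
    show "continuous_map euclidean euclideanreal d" if "d \<in> D" for d
      using that D(1) A by (auto simp: C_fun_def)
    show "separates_points D"
      unfolding separates_points_def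
    proof (intro allI impI)
      fix x y :: 'a assume "x \<noteq> y"
      then obtain f where f: "f \<in> A" "f x \<noteq> f y" using A(2) unfolding separates_points_def by blast
      then obtain U V where UV: "open U" "open V" "f x \<in> U" "f y \<in> V" "U \<inter> V = {}"
        using separation_t2[of "f x" "f y"] by blast
      then obtain d where "d \<in> D" "d x \<in> U" "d y \<in> V"
        using dense_meets_evaluation_conditions[OF \<tau>(2) A(1) f(1) D(2) UV(1-4)] by blast
      then show "\<exists>d\<in>D. d x \<noteq> d y" using UV(5) by (metis disjoint_iff)
    qed
    show "|D| \<le>o top_density (subtopology \<tau> A) +c natLeq"
      unfolding D(3)[symmetric] by (rule ordLeq_csum1) (rule Card_order_top_density)
  qed (auto simp: Cinfinite_csum_natLeq)
qed

text \<open>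
  One set of bounded Lipschitz functions is dense in all the spaces between \<open>Lip\<close> and \<open>C_fun\<close>. Its
  members need not vanish at \<open>e\<close>; for \<open>Lip0 e\<close> they are corrected by a constant, which costs a second
  \<open>\<epsilon>/2\<close> because \<open>f e = 0\<close>.
\<close>
lemma density_Lipschitz_subspaces_le_weak_weight:
  fixes \<tau> :: "('a::metric_space \<Rightarrow> real) topology"
  assumes \<tau>: "topspace \<tau> = C_fun" "\<And>U. openin \<tau> U \<Longrightarrow> openin compact_open_topology U"
    and A: "A = Lip0 e \<or> Lip \<subseteq> A \<and> A \<subseteq> C_fun"
  shows "top_density (subtopology \<tau> A) \<le>o weak_weight (euclidean :: 'a topology) +c natLeq"
    (is "_ \<le>o ?r")
proof -
  have "weak_weight (euclidean :: 'a topology) \<le>o ?r"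
    by (intro ordLeq_csum1 Card_order_weak_weight tychonoff_space_euclidean)
  then obtain E :: "('a \<Rightarrow> real) set" where E: "|E| \<le>o ?r" "E \<subseteq> Lip"
    "\<And>f K \<epsilon>. f \<in> C_fun \<Longrightarrow> compact K \<Longrightarrow> \<epsilon> > 0 \<Longrightarrow> \<exists>g\<in>E. \<forall>x\<in>K. \<bar>f x - g x\<bar> < \<epsilon>"
    using small_Lip_subset_approximating[OF _ Cinfinite_csum_natLeq] by metis
  from A show ?thesis
  proof
    assume A: "Lip \<subseteq> A \<and> A \<subseteq> C_fun"
    have "top_density (subtopology \<tau> A) \<le>o |E|"
      by (rule top_density_subspace_le[OF \<tau>]) (use A E in auto)
    then show ?thesis using E(1) ordLeq_transitive by metis
  next
    assume A: "A = Lip0 e"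
    define E0 where "E0 = (\<lambda>g x. g x - g e) ` E"
    have AC: "A \<subseteq> C_fun" using A Lip0_subset_LIP LIP_subset_C_fun by blast
    have "top_density (subtopology \<tau> A) \<le>o |E0|"
    proof (rule top_density_subspace_le[OF \<tau>])
      show "E0 \<subseteq> A"
        using E(2) Lip_subset_LIP subtract_value_in_Lip0 unfolding A E0_def by blast
    next
      fix f and K :: "'a set" and \<epsilon> :: real
      assume f: "f \<in> A" and K: "compact K" and \<epsilon>: "\<epsilon> > 0"
      have f0: "f e = 0" using f A by (simp add: Lip0_def)
      obtain g where g: "g \<in> E" "\<forall>x\<in>insert e K. \<bar>f x - g x\<bar> < \<epsilon>/2"
        using E(3)[of f "insert e K" "\<epsilon>/2"] f AC K \<epsilon> by auto
      have "\<bar>f x - (g x - g e)\<bar> < \<epsilon>" if "x \<in> K" for x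
      proof -
        have "\<bar>f x - g x\<bar> < \<epsilon>/2" "\<bar>f e - g e\<bar> < \<epsilon>/2" using g that by auto
        then show ?thesis using f0 by linarith
      qed
      then show "\<exists>g\<in>E0. \<forall>x\<in>K. \<bar>f x - g x\<bar> < \<epsilon>" using g(1) by (auto simp: E0_def)
    qed (use AC in simp_all)
    moreover have "|E0| \<le>o ?r" unfolding E0_def using E(1) by (rule image_ordLeq)
    ultimately show ?thesis using ordLeq_transitive by metis
  qed
qed

section \<open>Infinite spaces have infinite cardinal invariants\<close>

text \<open>The values of a dense set at \<open>x\<close> are unbounded above as soon as those of \<open>A\<close> are.\<close>
lemma Cinfinite_top_density_subspace:
  fixes \<tau> :: "('a::metric_space \<Rightarrow> real) topology"
  assumes \<tau>: "\<And>U. openin pointwise_topology U \<Longrightarrow> openin \<tau> U"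
    and A: "A \<subseteq> C_fun" and unb: "\<And>c. \<exists>f\<in>A. c < f x"
  shows "Cinfinite (top_density (subtopology \<tau> A))"
proof -
  obtain D where D: "D \<subseteq> topspace (subtopology \<tau> A)"
    "subtopology \<tau> A closure_of D = topspace (subtopology \<tau> A)" "top_density (subtopology \<tau> A) = |D|"
    using top_density_attained by metis
  have "\<exists>d\<in>D. c < d x" for c
  proof -
    obtain f where "f \<in> A" "c < f x" using unb by blast
    then show ?thesis
      using dense_meets_evaluation_conditions[OF \<tau> A _ D(2), of f "{c<..}" UNIV x x] by auto
  qed
  then have "\<not> bdd_above ((\<lambda>d. d x) ` D)"
    unfolding bdd_above_def by (auto simp: not_le)
  then have "infinite D" by (meson bdd_above_finite finite_imageI)
  then show ?thesis unfolding D(3) by (rule Cinfinite_card_of)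
qed

text \<open>A point of a Hausdorff space is determined by the basic open sets that contain it.\<close>
lemma Cinfinite_weak_weight:
  assumes X: "infinite (topspace X)" "tychonoff_space X"
  shows "Cinfinite (weak_weight X)"
proof -
  obtain Y \<phi> where Y: "tychonoff_space Y" "bij_betw \<phi> (topspace X) (topspace Y)" "weak_weight X = weight Y"
    using weak_weight_attained[OF X(2)] by metis
  obtain \<B> where \<B>: "is_base Y \<B>" "weight Y = |\<B>|" using weight_attained by blast
  have "inj_on (\<lambda>x. {V \<in> \<B>. x \<in> V}) (topspace Y)"
  proof (rule inj_onI, rule ccontr)
    fix x y assume xy: "x \<in> topspace Y" "y \<in> topspace Y" "{V \<in> \<B>. x \<in> V} = {V \<in> \<B>. y \<in> V}" "x \<noteq> y"
    then obtain U where "openin Y U" "x \<in> U" "y \<notin> U"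
      using Y(1) unfolding tychonoff_space_def Hausdorff_space_def disjnt_def by blast
    then show False using \<B>(1) xy(3) unfolding is_base_def by blast
  qed
  moreover have "infinite (topspace Y)" using X(1) Y(2) bij_betw_finite by blast
  moreover have "(\<lambda>x. {V \<in> \<B>. x \<in> V}) ` topspace Y \<subseteq> Pow \<B>" by blast
  ultimately have "infinite \<B>" by (meson finite_Pow_iff inj_on_finite)
  then show ?thesis unfolding Y(3) \<B>(2) by (rule Cinfinite_card_of)
qed

lemma Cinfinite_top_density_euclidean:
  assumes "infinite (UNIV :: 'a::metric_space set)"
  shows "Cinfinite (top_density (euclidean :: 'a::metric_space topology))"
proof -
  obtain D :: "'a set" where D: "closure D = UNIV" "top_density (euclidean :: 'a topology) = |D|"
    by (metis top_density_attained euclidean_closure_of topspace_euclidean)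
  have "infinite D" using D(1) assms by (metis closure_closed finite_imp_closed)
  then show ?thesis unfolding D(2) by (rule Cinfinite_card_of)
qed

theorem theorem3p13:
  fixes e :: "'a::metric_space" and \<tau> :: "('a \<Rightarrow> real) topology"
  assumes "topspace \<tau> = C_fun"
    and "\<And>U. openin pointwise_topology U \<Longrightarrow> openin \<tau> U"
    and "\<And>U. openin \<tau> U \<Longrightarrow> openin compact_open_topology U"
  shows
    "(infinite (UNIV :: 'a set) \<longrightarrow>
        weak_weight (euclidean :: 'a topology) =o top_density \<tau> \<and>
        top_density \<tau> =o top_density (subtopology \<tau> LIP) \<and>
        top_density (subtopology \<tau> LIP) =o top_density (subtopology \<tau> Lip) \<and>
        top_density (subtopology \<tau> Lip) =o top_density (subtopology \<tau> (Lip0 e)) \<and>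
        top_density (subtopology \<tau> (Lip0 e)) \<le>o top_density (euclidean :: 'a topology)) \<and>
     (weak_weight (euclidean :: 'a topology) +c natLeq =o top_density \<tau> +c natLeq \<and>
        top_density \<tau> +c natLeq =o top_density (subtopology \<tau> LIP) +c natLeq \<and>
        top_density (subtopology \<tau> LIP) +c natLeq =o top_density (subtopology \<tau> Lip) +c natLeq \<and>
        top_density (subtopology \<tau> Lip) +c natLeq =o top_density (subtopology \<tau> (Lip0 e)) +c natLeq \<and>
        top_density (subtopology \<tau> (Lip0 e)) +c natLeq \<le>o top_density (euclidean :: 'a topology) +c natLeq)"
proof -
  let ?w = "weak_weight (euclidean :: 'a topology)"
  let ?d = "\<lambda>A. top_density (subtopology \<tau> A)"
  let ?dM = "top_density (euclidean :: 'a topology)"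
  let ?N = "natLeq"
  have C: "top_density \<tau> = ?d C_fun" using subtopology_topspace[of \<tau>] assms(1) by simp
  have sub: "LIP \<subseteq> (C_fun :: ('a \<Rightarrow> real) set)" "Lip \<subseteq> (C_fun :: ('a \<Rightarrow> real) set)" "Lip0 e \<subseteq> C_fun"
    using LIP_subset_C_fun Lip_subset_LIP Lip0_subset_LIP by blast+
  have eq: "?w +c ?N =o ?d A +c ?N"
    if A: "A = Lip0 e \<or> Lip \<subseteq> A \<and> A \<subseteq> C_fun" for A
  proof -
    have "A \<subseteq> C_fun" "separates_points A"
      using A sub separates_points_Lip0 separates_points_mono[OF separates_points_Lip] by blast+
    then have 1: "?w \<le>o ?d A +c ?N"
      using weak_weight_le_density_subspace[OF assms(1,2)] by blast
    have 2: "?d A \<le>o ?w +c ?N"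
      using density_Lipschitz_subspaces_le_weak_weight[OF assms(1,3) A] .
    have "?w +c ?N \<le>o ?d A +c ?N"
      by (intro csum_cinfinite_bound 1 ordLeq_csum2 natLeq_Card_order Card_order_weak_weight
        tychonoff_space_euclidean Cinfinite_csum_natLeq)
    moreover have "?d A +c ?N \<le>o ?w +c ?N"
      by (intro csum_cinfinite_bound 2 ordLeq_csum2 natLeq_Card_order Card_order_top_density Cinfinite_csum_natLeq)
    ultimately show ?thesis by (simp add: ordIso_iff_ordLeq)
  qed
  have eqs: "?w +c ?N =o ?d C_fun +c ?N" "?w +c ?N =o ?d LIP +c ?N"
    "?w +c ?N =o ?d Lip +c ?N" "?w +c ?N =o ?d (Lip0 e) +c ?N"
    by (rule eq, use sub Lip_subset_LIP in auto)+
  have wM: "?w +c ?N \<le>o ?dM +c ?N"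
    by (intro csum_cinfinite_bound weak_weight_le_density ordLeq_csum2 natLeq_Card_order
        Card_order_weak_weight tychonoff_space_euclidean Cinfinite_csum_natLeq)
  have chain: "?d C_fun +c ?N =o ?d LIP +c ?N" "?d LIP +c ?N =o ?d Lip +c ?N"
    "?d Lip +c ?N =o ?d (Lip0 e) +c ?N" "?d (Lip0 e) +c ?N \<le>o ?dM +c ?N"
    using eqs wM by (meson ordIso_symmetric ordIso_transitive ordIso_ordLeq_trans)+
  show ?thesis
  proof (intro conjI impI)
    assume inf: "infinite (UNIV :: 'a set)"
    have iw: "Cinfinite ?w" and iM: "Cinfinite ?dM"
      using Cinfinite_weak_weight[OF _ tychonoff_space_euclidean] Cinfinite_top_density_euclidean inf
      by auto
    have i: "Cinfinite (?d A)" if "Lip \<subseteq> A" "A \<subseteq> C_fun" for A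
    proof (rule Cinfinite_top_density_subspace[OF assms(2) that(2)])
      show "\<exists>f\<in>A. c < f e" for c
        using const_in_Lip[of "c + 1"] that(1) by (intro bexI[of _ "\<lambda>_. c + 1"]) auto
    qed
    have iC: "Cinfinite (?d C_fun)" "Cinfinite (?d LIP)" "Cinfinite (?d Lip)"
      using i sub Lip_subset_LIP by blast+
    obtain a :: 'a where a: "a \<noteq> e" using inf by (metis ex_new_if_finite finite.intros singletonI)
    \<comment> \<open>Functions in \<open>Lip0 e\<close> are unbounded at a point only if it differs from \<open>e\<close>.\<close>
    have i0: "Cinfinite (?d (Lip0 e))"
    proof (rule Cinfinite_top_density_subspace[OF assms(2) sub(3)])
      show "\<exists>f\<in>Lip0 e. c < f a" for c
      proof (rule bexI[of _ "\<lambda>x. (c + 1) / dist a e * dist x e"])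
        show "c < (c + 1) / dist a e * dist a e" using a by simp
      qed (rule cmult_dist_in_Lip0)
    qed
    show "?w =o top_density \<tau>" unfolding C using eqs(1) iw iC(1) by (rule csum_natLeq_cancel)
    show "top_density \<tau> =o ?d LIP" unfolding C using chain(1) iC(1,2) by (rule csum_natLeq_cancel)
    show "?d LIP =o ?d Lip" using chain(2) iC(2,3) by (rule csum_natLeq_cancel)
    show "?d Lip =o ?d (Lip0 e)" using chain(3) iC(3) i0 by (rule csum_natLeq_cancel)
    have "?d (Lip0 e) \<le>o ?d (Lip0 e) +c ?N" using i0 ordLeq_csum1 by blast
    also have "?d (Lip0 e) +c ?N \<le>o ?dM +c ?N" by (rule chain(4))
    also have "?dM +c ?N =o ?dM" using iM by (rule csum_natLeq_absorb)
    finally show "?d (Lip0 e) \<le>o ?dM" .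
  qed (use eqs chain C in auto)
qed

end
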